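(* There exists no complete convex modular graph in $\mathbb{E}^3$ of constant Gaussian curvature; or equivalently, there is no modular graph in $\mathbb{E}^3$ of constant positive Gaussian curvature.
   Context: $\mathbb{E}^3$ is Euclidean 3-space, i.e. $\mathbb{R}^3$ with the metric $dx^2+dy^2+dt^2$. A modular graph (modular surface) is a graph $(x,y,h(x,y))$ over a domain (open connected subset) $D$ of $\mathbb{R}^2\cong\mathbb{C}$ with $h=|F|$ for an analytic function $F$ on $D$; here the height function $h$ is taken to be positive and log-harmonic, i.e. $\log h$ is harmonic, equivalently $h\,\Delta h=|\nabla h|^2$ (on a simply connected domain, a positive $h$ is the height function of a modular surface if and only if it is log-harmonic). A modular graph is convex if $h_{xx}h_{yy}-h_{xy}^2>0$. It is called complete if the exponential map defined on the tangent space of any point of the surface is a diffeomorphism onto $\mathbb{R}^2$. The Gaussian curvature of the graph in $\mathbb{E}^3$ is $$K=\frac{h_{xx}h_{yy}-h_{xy}^2}{(1+|\nabla h|^2)^2}=\frac{h_{xx}h_{yy}-h_{xy}^2}{(1+h\,\Delta h)^2}.$$ *)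

theory Defs
  imports "HOL-Complex_Analysis.Complex_Analysis"
begin

text \<open>
  The plane of the variables $(x,y)$ is the type \<open>complex\<close>, and Euclidean 3-space is the inner
  product space \<open>complex \<times> real\<close>, whose metric is $dx^2+dy^2+dt^2$.  Height functions are total
  functions on \<open>complex\<close>, but only their values on the (open) domain \<open>D\<close> matter.
\<close>

definition pdx :: "(complex \<Rightarrow> real) \<Rightarrow> complex \<Rightarrow> real" where
  "pdx h z = frechet_derivative h (at z) 1"

definition pdy :: "(complex \<Rightarrow> real) \<Rightarrow> complex \<Rightarrow> real" where
  "pdy h z = frechet_derivative h (at z) \<i>"

definition hessian_det :: "(complex \<Rightarrow> real) \<Rightarrow> complex \<Rightarrow> real" where
  "hessian_det h z = pdx (pdx h) z * pdy (pdy h) z - (pdy (pdx h) z)\<^sup>2"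

definition gauss_curvature :: "(complex \<Rightarrow> real) \<Rightarrow> complex \<Rightarrow> real" where
  "gauss_curvature h z = hessian_det h z / (1 + (pdx h z)\<^sup>2 + (pdy h z)\<^sup>2)\<^sup>2"

text \<open>
  As \<open>F\<close> has no zeros when \<open>h\<close> is positive, log-harmonicity of the height function is a
  consequence of this definition: see \<open>modular_graph_log_harmonic\<close> below.
\<close>

definition modular_graph :: "complex set \<Rightarrow> (complex \<Rightarrow> real) \<Rightarrow> bool" where
  "modular_graph D h \<longleftrightarrow> open D \<and> connected D \<and> D \<noteq> {} \<and>
     (\<exists>F. F analytic_on D \<and> (\<forall>z\<in>D. h z = cmod (F z))) \<and> (\<forall>z\<in>D. 0 < h z)"

definition convex_graph :: "complex set \<Rightarrow> (complex \<Rightarrow> real) \<Rightarrow> bool" where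
  "convex_graph D h \<longleftrightarrow> (\<forall>z\<in>D. 0 < hessian_det h z)"

definition height_graph :: "complex set \<Rightarrow> (complex \<Rightarrow> real) \<Rightarrow> (complex \<times> real) set" where
  "height_graph D h = (\<lambda>z. (z, h z)) ` D"

definition lift_tangent :: "(complex \<Rightarrow> real) \<Rightarrow> complex \<Rightarrow> complex \<Rightarrow> complex \<times> real" where
  "lift_tangent h z w = (w, frechet_derivative h (at z) w)"

text \<open>The tangent space of the graph at the point \<open>(z, h z)\<close>, as a subspace of Euclidean 3-space.\<close>

definition tangent_plane :: "(complex \<Rightarrow> real) \<Rightarrow> complex \<Rightarrow> (complex \<times> real) set" where
  "tangent_plane h z = range (lift_tangent h z)"

text \<open>
  Geodesics of the metric induced on the graph: curves in the surface whose acceleration in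
  Euclidean 3-space is everywhere normal to the surface.  The curve starts at \<open>(z, h z)\<close> with
  velocity \<open>v\<close> and is parametrised by the unit interval.
\<close>

definition geodesic_from ::
  "complex set \<Rightarrow> (complex \<Rightarrow> real) \<Rightarrow> complex \<Rightarrow> complex \<times> real \<Rightarrow> (real \<Rightarrow> complex \<times> real) \<Rightarrow> bool" where
  "geodesic_from D h z v \<gamma> \<longleftrightarrow> \<gamma> 0 = (z, h z) \<and>
     (\<exists>\<gamma>' \<gamma>''. \<gamma>' 0 = v \<and>
       (\<forall>t\<in>{0..1}. \<gamma> t \<in> height_graph D h \<and>
          (\<gamma> has_vector_derivative \<gamma>' t) (at t within {0..1}) \<and>
          (\<gamma>' has_vector_derivative \<gamma>'' t) (at t within {0..1}) \<and>
          (\<forall>u\<in>tangent_plane h (fst (\<gamma> t)). \<gamma>'' t \<bullet> u = 0)))"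

text \<open>The exponential map is only meaningful on those \<open>v\<close> for which such a geodesic exists.\<close>

definition exp_map ::
  "complex set \<Rightarrow> (complex \<Rightarrow> real) \<Rightarrow> complex \<Rightarrow> complex \<times> real \<Rightarrow> complex \<times> real" where
  "exp_map D h z v = (THE q. \<exists>\<gamma>. geodesic_from D h z v \<gamma> \<and> \<gamma> 1 = q)"

text \<open>Continuous differentiability of order \<open>k\<close>; only used for open \<open>S\<close>.\<close>

primrec Ck_on ::
  "nat \<Rightarrow> ('a::real_normed_vector \<Rightarrow> 'b::real_normed_vector) \<Rightarrow> 'a set \<Rightarrow> bool" where
  "Ck_on 0 f S \<longleftrightarrow> continuous_on S f"
| "Ck_on (Suc k) f S \<longleftrightarrow> (\<forall>x\<in>S. f differentiable (at x)) \<and>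
     (\<forall>v. Ck_on k (\<lambda>x. frechet_derivative f (at x) v) S)"

definition diffeo_between ::
  "'a::euclidean_space set \<Rightarrow> 'b::euclidean_space set \<Rightarrow> ('a \<Rightarrow> 'b) \<Rightarrow> bool" where
  "diffeo_between U V f \<longleftrightarrow> open U \<and> open V \<and> bij_betw f U V \<and>
     (\<forall>k. Ck_on k f U) \<and> (\<forall>k. Ck_on k (inv_into U f) V)"

text \<open>
  The exponential map at every point is defined on the whole tangent plane and is a
  diffeomorphism of it onto the surface, which thus is itself diffeomorphic to the plane.
  Smoothness is expressed in the linear coordinate \<open>w \<mapsto> lift_tangent h z w\<close> on the tangent plane
  and in the global chart \<open>fst\<close> on the graph, so the map to consider goes from the plane to \<open>D\<close>.
\<close>

definition complete_surface :: "complex set \<Rightarrow> (complex \<Rightarrow> real) \<Rightarrow> bool" where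
  "complete_surface D h \<longleftrightarrow> (\<forall>z\<in>D.
     (\<forall>v\<in>tangent_plane h z. \<exists>\<gamma>. geodesic_from D h z v \<gamma>) \<and>
     diffeo_between UNIV D (\<lambda>w. fst (exp_map D h z (lift_tangent h z w))))"

lemma pd_cong:
  assumes "open D" "z \<in> D" "\<And>x. x \<in> D \<Longrightarrow> f x = g x"
  shows "pdx f z = pdx g z" "pdy f z = pdy g z"
proof -
  have "(f has_derivative f') (at z) \<longleftrightarrow> (g has_derivative f') (at z)" for f'
    using assms has_derivative_transform_within_open[of f f' z UNIV D g]
      has_derivative_transform_within_open[of g f' z UNIV D f] by auto
  then show "pdx f z = pdx g z" "pdy f z = pdy g z"
    by (simp_all add: pdx_def pdy_def frechet_derivative_def)
qed

lemma pd_has_derivative: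
  assumes "(f has_derivative f') (at z)"
  shows "pdx f z = f' 1" "pdy f z = f' \<i>"
  using frechet_derivative_at[OF assms] by (simp_all add: pdx_def pdy_def)

lemma modular_graph_log_harmonic:
  assumes "modular_graph D h" "z \<in> D"
  defines "u \<equiv> \<lambda>z. ln (h z)"
  shows "pdx (pdx u) z + pdy (pdy u) z = 0"
proof -
  obtain F where D: "open D" and F: "F analytic_on D" "\<And>z. z \<in> D \<Longrightarrow> h z = cmod (F z)"
    and pos: "\<And>z. z \<in> D \<Longrightarrow> 0 < h z"
    using assms(1) unfolding modular_graph_def by blast
  have nz: "F x \<noteq> 0" if "x \<in> D" for x using F(2) pos that by fastforce
  have hol: "F holomorphic_on D" using F(1) by (simp add: analytic_imp_holomorphic)
  define G where "G = (\<lambda>z. deriv F z / F z)"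
  have "G holomorphic_on D"
    unfolding G_def using hol nz D by (intro holomorphic_intros) auto
  then have G: "(G has_field_derivative deriv G x) (at x)" if "x \<in> D" for x
    using D that holomorphic_derivI by blast
  have du: "(u has_derivative (\<lambda>w. Re (G x * w))) (at x)" if "x \<in> D" for x
  proof -
    have dF: "(F has_derivative (\<lambda>w. deriv F x * w)) (at x)"
      using hol D that holomorphic_derivI has_field_derivative_imp_has_derivative by blast
    have "((\<lambda>y. ln (cmod (F y))) has_derivative
        (\<lambda>w. (1 / cmod (F x)) * (inner (sgn (F x)) (deriv F x * w)))) (at x)"
      using dF nz[OF that] by (auto intro!: derivative_eq_intros has_derivative_compose[OF dF has_derivative_norm]
          simp: divide_simps inner_commute)
    moreover have "(1 / cmod (F x)) * (inner (sgn (F x)) (deriv F x * w)) = Re (G x * w)" for w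
    proof -
      have "G x * w = deriv F x * w * cnj (F x) / of_real ((cmod (F x))\<^sup>2)"
        using nz[OF that] unfolding G_def complex_norm_square by (simp add: field_simps)
      then have "Re (G x * w) = Re (deriv F x * w * cnj (F x)) / (cmod (F x))\<^sup>2"
        by (simp only: Re_divide_of_real)
      also have "\<dots> = (1 / cmod (F x)) * (inner (sgn (F x)) (deriv F x * w))"
        by (simp add: sgn_div_norm inner_complex_def power2_eq_square divide_inverse algebra_simps)
      finally show ?thesis by simp
    qed
    ultimately have "((\<lambda>y. ln (cmod (F y))) has_derivative (\<lambda>w. Re (G x * w))) (at x)" by simp
    then show ?thesis
      by (rule has_derivative_transform_within_open[OF _ D that]) (simp add: u_def F)
  qed
  have ux: "pdx u x = Re (G x)" and uy: "pdy u x = Re (G x * \<i>)" if "x \<in> D" for x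
    using pd_has_derivative[OF du[OF that]] by simp_all
  have dG: "(G has_derivative (\<lambda>w. deriv G z * w)) (at z)"
    using G[OF assms(2)] by (simp add: has_field_derivative_imp_has_derivative)
  have "((\<lambda>x. Re (G x)) has_derivative (\<lambda>w. Re (deriv G z * w))) (at z)"
    "((\<lambda>x. Re (G x * \<i>)) has_derivative (\<lambda>w. Re (deriv G z * w * \<i>))) (at z)"
    using has_derivative_Re[OF dG] has_derivative_Re[OF has_derivative_mult_left[OF dG, of \<i>]]
    by simp_all
  from pd_has_derivative(1)[OF this(1)] pd_has_derivative(2)[OF this(2)] show ?thesis
    using pd_cong(1)[OF D assms(2) ux] pd_cong(2)[OF D assms(2) uy] by simp
qed

end

theory Submission
  imports Defs
begin

text \<open>
  Both parts are consequences of a local fact: a positive constant curvature is impossible.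
  A convex graph has positive curvature, so the first part is an instance of it.

  Write \<open>h = \<bar>F\<bar>\<close> and \<open>G = F'/F\<close>, so that \<open>F G\<^sup>2\<close> and the other functions below are
  holomorphic. A computation gives
  \<open>h\<^sub>x\<^sub>x h\<^sub>y\<^sub>y - h\<^sub>x\<^sub>y\<^sup>2 = \<bar>F G\<^sup>2/2\<bar>\<^sup>2 - \<bar>F (G' + G\<^sup>2/2)\<bar>\<^sup>2\<close>, while \<open>\<bar>\<nabla>h\<bar> = \<bar>F G\<bar>\<close>. Therefore
  curvature \<open>K\<close> means
  \<open>\<bar>F G\<^sup>2/2\<bar>\<^sup>2 = \<bar>F (G' + G\<^sup>2/2)\<bar>\<^sup>2 + K (1 + 2 \<bar>F G\<bar>\<^sup>2 + \<bar>F\<^sup>2 G\<^sup>2\<bar>\<^sup>2)\<close>.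
  If \<open>K > 0\<close>, the right-hand side is a sum of squared moduli of holomorphic functions, and the
  left-hand side has no zeros. Dividing by the latter, the squared moduli of the quotients add up to 1.
  By the maximum principle (\<open>sum_norm_squares_constant_imp_constant\<close>) each quotient is then
  constant. One of them is \<open>2 \<surd>K F\<close>. Hence \<open>F\<close> is constant and \<open>G = 0\<close>, which contradicts
  the absence of zeros.
\<close>

text \<open>
  The functions form a holomorphic curve on a sphere of a Hermitian space. Its Hermitian product
  with one of its own points has modulus at most the squared radius, and attains that bound at
  this point. By the maximum modulus principle the product is constant, and a point of the sphere
  whose product with a given one equals the squared radius coincides with it.
\<close>

lemma sum_norm_squares_constant_imp_constant:
  fixes g :: "'i \<Rightarrow> complex \<Rightarrow> complex"
  assumes "finite I" "open D" "connected D"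
    and hol: "\<And>i. i \<in> I \<Longrightarrow> g i holomorphic_on D"
    and sq: "\<And>z. z \<in> D \<Longrightarrow> (\<Sum>i\<in>I. (cmod (g i z))\<^sup>2) = C"
    and "i \<in> I"
  shows "g i constant_on D"
proof -
  have "g i z = g i z0" if z: "z \<in> D" and z0: "z0 \<in> D" for z z0
  proof -
    define \<phi> where "\<phi> w = (\<Sum>i\<in>I. g i w * cnj (g i z0))" for w
    have \<phi>_z0: "\<phi> z0 = of_real C"
    proof -
      have "\<phi> z0 = of_real (\<Sum>i\<in>I. (cmod (g i z0))\<^sup>2)"
        by (simp add: \<phi>_def complex_norm_square del: of_real_power)
      then show ?thesis using sq[OF z0] by simp
    qed
    have "cmod (\<phi> w) \<le> C" if "w \<in> D" for w
    proof -
      have "cmod (\<phi> w) \<le> (\<Sum>i\<in>I. cmod (g i w) * cmod (g i z0))"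
        unfolding \<phi>_def by (rule order_trans[OF norm_sum]) (simp add: norm_mult)
      also have "\<dots> \<le> (\<Sum>i\<in>I. ((cmod (g i w))\<^sup>2 + (cmod (g i z0))\<^sup>2) / 2)"
        using sum_squares_bound[of "cmod (g _ w)" "cmod (g _ z0)"]
        by (intro sum_mono) (simp add: field_simps)
      also have "\<dots> = C"
        using sq[OF that] sq[OF z0] by (simp add: sum.distrib flip: sum_divide_distrib)
      finally show ?thesis .
    qed
    moreover have "cmod (\<phi> z0) = C"
      using \<phi>_z0 sum_nonneg[of I "\<lambda>i. (cmod (g i z0))\<^sup>2"] sq[OF z0] by simp
    moreover have "\<phi> holomorphic_on D"
      unfolding \<phi>_def by (intro holomorphic_intros hol)
    ultimately have "\<phi> constant_on D"
      using maximum_modulus_principle[of \<phi> D D z0] assms(2,3) z0 by auto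
    then have "\<phi> z = of_real C"
      using z z0 \<phi>_z0 by (metis constant_on_def)
    have "(cmod (g i z - g i z0))\<^sup>2
        = (cmod (g i z))\<^sup>2 + (cmod (g i z0))\<^sup>2 - 2 * Re (g i z * cnj (g i z0))" for i
      unfolding cmod_power2 by (simp add: power2_eq_square algebra_simps)
    then have "(\<Sum>i\<in>I. (cmod (g i z - g i z0))\<^sup>2) = C + C - 2 * Re (\<phi> z)"
      using sq[OF z] sq[OF z0]
      by (simp add: \<phi>_def sum.distrib sum_subtractf sum_distrib_left)
    with \<open>\<phi> z = of_real C\<close> have "(\<Sum>i\<in>I. (cmod (g i z - g i z0))\<^sup>2) = 0"
      by simp
    with \<open>finite I\<close> \<open>i \<in> I\<close> show ?thesis
      by (simp add: sum_nonneg_eq_0_iff)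
  qed
  then show ?thesis
    unfolding constant_on_def by blast
qed

text \<open>
  The derivative of \<open>\<bar>F\<bar> = exp (Re (log F))\<close>, whatever branch of the logarithm is taken.
\<close>

lemma norm_has_derivative_log_deriv:
  assumes "(F has_field_derivative F') (at z)" "F z \<noteq> 0"
  shows "((\<lambda>x. cmod (F x)) has_derivative (\<lambda>w. cmod (F z) * Re (F' / F z * w))) (at z)"
proof -
  have "(F has_derivative (\<lambda>w. F' * w)) (at z)"
    using assms(1) by (simp add: has_field_derivative_imp_has_derivative)
  then have "((\<lambda>x. cmod (F x)) has_derivative (\<lambda>w. inner (sgn (F z)) (F' * w))) (at z)"
    using has_derivative_compose[of F "\<lambda>w. F' * w" z UNIV, OF _ has_derivative_norm[OF assms(2)]]
    by (simp add: inner_commute)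
  moreover have "inner (sgn (F z)) (F' * w) = cmod (F z) * Re (F' / F z * w)" for w
  proof -
    have "F' / F z * w = F' * w * cnj (F z) / of_real ((cmod (F z))\<^sup>2)"
      using assms(2) unfolding complex_norm_square by (simp add: field_simps)
    then have "cmod (F z) * Re (F' / F z * w)
        = cmod (F z) * (Re (F' * w * cnj (F z)) / (cmod (F z))\<^sup>2)"
      by (simp only: Re_divide_of_real)
    also have "\<dots> = Re (F' * w * cnj (F z)) / cmod (F z)"
      using assms(2) by (simp add: power2_eq_square)
    also have "\<dots> = inner (F z) (F' * w) / cmod (F z)"
      by (simp add: inner_complex_def algebra_simps)
    also have "\<dots> = inner (sgn (F z)) (F' * w)"
      by (simp add: sgn_div_norm divide_inverse)
    finally show ?thesis by simp
  qed
  ultimately show ?thesis by simp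
qed

text \<open>
  Locally \<open>h = exp u\<close> with \<open>u = Re (log F)\<close>, so \<open>h\<^sub>i\<^sub>j = h (u\<^sub>i\<^sub>j + u\<^sub>i u\<^sub>j)\<close>, where the gradient of
  \<open>u\<close> is \<open>(Re G, -Im G)\<close> and its second derivatives are read off from \<open>G'\<close>. The determinant is
  \<open>h\<^sup>2 (- \<bar>G'\<bar>\<^sup>2 - Re (G' cnj G\<^sup>2))\<close>; completing the square turns it into the difference of two
  squared moduli of holomorphic functions, which is the form that the maximum principle needs.
\<close>

lemma norm_graph_derivatives:
  assumes D: "open D" and F: "F holomorphic_on D" and nz: "\<And>x. x \<in> D \<Longrightarrow> F x \<noteq> 0"
    and h: "\<And>x. x \<in> D \<Longrightarrow> h x = cmod (F x)" and z: "z \<in> D"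
    and G_def: "G = (\<lambda>x. deriv F x / F x)"
  shows "(pdx h z)\<^sup>2 + (pdy h z)\<^sup>2 = (cmod (F z * G z))\<^sup>2"
    and "hessian_det h z = (cmod (F z * (G z)\<^sup>2 / 2))\<^sup>2
           - (cmod (F z * (deriv G z + (G z)\<^sup>2 / 2)))\<^sup>2"
proof -
  have "G holomorphic_on D"
    unfolding G_def using F nz D by (intro holomorphic_intros) auto
  then have "(G has_field_derivative deriv G z) (at z)"
    using D z holomorphic_derivI by blast
  then have dG: "(G has_derivative (\<lambda>w. deriv G z * w)) (at z)"
    by (simp add: has_field_derivative_imp_has_derivative)
  have dh: "(h has_derivative (\<lambda>w. h x * Re (G x * w))) (at x)" if "x \<in> D" for x
  proof -
    have "((\<lambda>x. cmod (F x)) has_derivative (\<lambda>w. cmod (F x) * Re (G x * w))) (at x)"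
      unfolding G_def using norm_has_derivative_log_deriv nz that F D holomorphic_derivI by blast
    then have "(h has_derivative (\<lambda>w. cmod (F x) * Re (G x * w))) (at x)"
      by (rule has_derivative_transform_within_open[OF _ D that]) (simp add: h)
    then show ?thesis by (simp add: h that)
  qed
  have hx: "pdx h x = h x * Re (G x)" and hy: "pdy h x = - (h x * Im (G x))" if "x \<in> D" for x
    using pd_has_derivative[OF dh[OF that]] by simp_all
  have dhx: "((\<lambda>x. h x * Re (G x)) has_derivative
      (\<lambda>w. h z * Re (deriv G z * w) + h z * Re (G z * w) * Re (G z))) (at z)"
    by (rule has_derivative_mult[OF dh[OF z] has_derivative_Re[OF dG]])
  have dhy: "((\<lambda>x. - (h x * Im (G x))) has_derivative
      (\<lambda>w. - (h z * Im (deriv G z * w) + h z * Re (G z * w) * Im (G z)))) (at z)"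
    by (rule has_derivative_minus[OF has_derivative_mult[OF dh[OF z] has_derivative_Im[OF dG]]])
  have hxx: "pdx (pdx h) z = h z * (Re (deriv G z) + (Re (G z))\<^sup>2)"
    using pd_cong(1)[OF D z hx] pd_has_derivative(1)[OF dhx]
    by (simp add: power2_eq_square algebra_simps)
  have hxy: "pdy (pdx h) z = - h z * (Im (deriv G z) + Re (G z) * Im (G z))"
    using pd_cong(2)[OF D z hx] pd_has_derivative(2)[OF dhx]
    by (simp add: algebra_simps)
  have hyy: "pdy (pdy h) z = h z * ((Im (G z))\<^sup>2 - Re (deriv G z))"
    using pd_cong(2)[OF D z hy] pd_has_derivative(2)[OF dhy]
    by (simp add: power2_eq_square algebra_simps)
  show "(pdx h z)\<^sup>2 + (pdy h z)\<^sup>2 = (cmod (F z * G z))\<^sup>2"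
    unfolding hx[OF z] hy[OF z] h[OF z]
    by (simp add: norm_mult power_mult_distrib cmod_power2[of "G z"] distrib_left)
  have norm_diff: "(cmod (c\<^sup>2 / 2))\<^sup>2 - (cmod (d + c\<^sup>2 / 2))\<^sup>2
      = (Re d + (Re c)\<^sup>2) * ((Im c)\<^sup>2 - Re d) - (Im d + Re c * Im c)\<^sup>2" for c d :: complex
    unfolding cmod_power2 by (simp add: power2_eq_square field_simps)
  have "hessian_det h z = (cmod (F z))\<^sup>2 *
      ((Re (deriv G z) + (Re (G z))\<^sup>2) * ((Im (G z))\<^sup>2 - Re (deriv G z))
        - (Im (deriv G z) + Re (G z) * Im (G z))\<^sup>2)"
    unfolding hessian_det_def hxx hxy hyy h[OF z]
    by (simp add: power2_eq_square algebra_simps)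
  also have "\<dots> = (cmod (F z))\<^sup>2 *
      ((cmod ((G z)\<^sup>2 / 2))\<^sup>2 - (cmod (deriv G z + (G z)\<^sup>2 / 2))\<^sup>2)"
    by (simp only: norm_diff)
  finally show "hessian_det h z = (cmod (F z * (G z)\<^sup>2 / 2))\<^sup>2
           - (cmod (F z * (deriv G z + (G z)\<^sup>2 / 2)))\<^sup>2"
    by (simp add: norm_mult norm_divide power_mult_distrib power_divide right_diff_distrib)
qed

lemma no_modular_graph_constant_positive_curvature:
  assumes "modular_graph D h" "K > 0" and curv: "\<And>z. z \<in> D \<Longrightarrow> gauss_curvature h z = K"
  shows False
proof -
  obtain F where D: "open D" "connected D" "D \<noteq> {}" and "F analytic_on D"
    and h: "\<And>z. z \<in> D \<Longrightarrow> h z = cmod (F z)" and pos: "\<And>z. z \<in> D \<Longrightarrow> 0 < h z"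
    using assms(1) unfolding modular_graph_def by blast
  then have F: "F holomorphic_on D" by (simp add: analytic_imp_holomorphic)
  have nz: "F z \<noteq> 0" if "z \<in> D" for z using h pos that by fastforce
  define G where "G = (\<lambda>z. deriv F z / F z)"
  have G: "G holomorphic_on D"
    unfolding G_def using F nz D by (intro holomorphic_intros) auto
  then have G': "deriv G holomorphic_on D"
    using D(1) by (intro holomorphic_intros)
  have squares: "(cmod (F z * (G z)\<^sup>2 / 2))\<^sup>2 = (cmod (F z * (deriv G z + (G z)\<^sup>2 / 2)))\<^sup>2
      + K * (1 + (cmod (F z * G z))\<^sup>2)\<^sup>2" if z: "z \<in> D" for z
  proof -
    note derivs = norm_graph_derivatives[OF D(1) F nz h z G_def]
    have "1 + (cmod (F z * G z))\<^sup>2 > 0"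
      by (simp add: add_pos_nonneg)
    moreover have "hessian_det h z / (1 + (cmod (F z * G z))\<^sup>2)\<^sup>2 = K"
      using curv[OF z] by (simp only: gauss_curvature_def add.assoc derivs(1))
    ultimately have "hessian_det h z = K * (1 + (cmod (F z * G z))\<^sup>2)\<^sup>2"
      by (simp add: divide_eq_eq)
    then show ?thesis using derivs(2) by linarith
  qed
  have Gnz: "G z \<noteq> 0" if "z \<in> D" for z
  proof
    assume "G z = 0"
    then have "(cmod (F z * deriv G z))\<^sup>2 + K = 0" using squares[OF that] by simp
    with \<open>K > 0\<close> show False by (smt (verit) zero_le_power2)
  qed
  (* The holomorphic functions whose squared moduli make up the right-hand side of squares,
     each divided by F G^2 / 2. *)
  define g where "g i = [\<lambda>z. 1 + 2 * deriv G z / (G z)\<^sup>2, \<lambda>z. of_real (2 * sqrt K) / (F z * (G z)\<^sup>2),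
    \<lambda>z. of_real (2 * sqrt (2 * K)) / G z, \<lambda>z. of_real (2 * sqrt K) * F z] ! i" for i
  have "g 3 constant_on D"
  proof (rule sum_norm_squares_constant_imp_constant[where I = "{..<4}" and C = 1])
    fix i :: nat assume "i \<in> {..<4}"
    then consider "i = 0" | "i = 1" | "i = 2" | "i = 3" by fastforce
    then show "g i holomorphic_on D"
      by cases (auto simp: g_def nz Gnz intro!: holomorphic_intros F G G')
  next
    fix z assume z: "z \<in> D"
    define f c d where "f = cmod (F z)" and "c = cmod (G z)"
      and "d = cmod (deriv G z + (G z)\<^sup>2 / 2)"
    have fc: "f > 0" "c > 0" using nz[OF z] Gnz[OF z] by (simp_all add: f_def c_def)
    have "1 + 2 * deriv G z / (G z)\<^sup>2 = 2 * (deriv G z + (G z)\<^sup>2 / 2) / (G z)\<^sup>2"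
      using Gnz[OF z] by (simp add: field_simps)
    then have "g 0 z = 2 * (deriv G z + (G z)\<^sup>2 / 2) / (G z)\<^sup>2"
      by (simp add: g_def)
    then have n0: "cmod (g 0 z) = 2 * d / c\<^sup>2"
      by (simp only: norm_mult norm_divide norm_power norm_numeral c_def d_def)
    have n1: "cmod (g 1 z) = 2 * sqrt K / (f * c\<^sup>2)" and n2: "cmod (g 2 z) = 2 * sqrt (2 * K) / c"
      and n3: "cmod (g 3 z) = 2 * sqrt K * f"
      using \<open>K > 0\<close> by (simp_all add: g_def norm_mult norm_divide norm_power c_def f_def)
    have "(f * c\<^sup>2 / 2)\<^sup>2 = (f * d)\<^sup>2 + K * (1 + (f * c)\<^sup>2)\<^sup>2"
      using squares[OF z] by (simp add: norm_mult norm_divide norm_power f_def c_def d_def)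
    then have "f\<^sup>2 * c^4 = 4 * f\<^sup>2 * d\<^sup>2 + 4 * K + 8 * K * f\<^sup>2 * c\<^sup>2 + 4 * K * f^4 * c^4"
      by (simp add: power2_eq_square power4_eq_xxxx field_simps)
    then have "1 = (4 * f\<^sup>2 * d\<^sup>2 + 4 * K + 8 * K * f\<^sup>2 * c\<^sup>2 + 4 * K * f^4 * c^4) / (f\<^sup>2 * c^4)"
      using fc by (metis divide_self mult_pos_pos less_irrefl zero_less_power)
    also have "\<dots> = (2 * d / c\<^sup>2)\<^sup>2 + (2 * sqrt K / (f * c\<^sup>2))\<^sup>2 + (2 * sqrt (2 * K) / c)\<^sup>2
        + (2 * sqrt K * f)\<^sup>2"
      using fc \<open>K > 0\<close>
      by (simp add: power_mult_distrib power_divide real_sqrt_mult)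
        (simp add: power2_eq_square power4_eq_xxxx field_simps)
    also have "\<dots> = (\<Sum>i<4. (cmod (g i z))\<^sup>2)"
      using n0 n1 n2 n3 by (simp add: eval_nat_numeral)
    finally show "(\<Sum>i<4. (cmod (g i z))\<^sup>2) = 1" by simp
  qed (use D in auto)
  then obtain a where "of_real (2 * sqrt K) * F z = a" if "z \<in> D" for z
    unfolding constant_on_def g_def by auto
  then have const: "F z = a / of_real (2 * sqrt K)" if "z \<in> D" for z
    using that \<open>K > 0\<close> by (auto simp: field_simps)
  obtain z where z: "z \<in> D" using D(3) by blast
  have "(F has_field_derivative 0) (at z)"
    by (rule has_field_derivative_transform_within_open[OF DERIV_const D(1) z])
      (simp add: const)
  then have "G z = 0" by (simp add: G_def DERIV_imp_deriv)
  with Gnz[OF z] show False by simp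
qed

theorem proposition5p2:
  shows "(\<not> (\<exists>(D :: complex set) (h :: complex \<Rightarrow> real).
             modular_graph D h \<and> complete_surface D h \<and> convex_graph D h \<and>
             (\<exists>K. \<forall>z\<in>D. gauss_curvature h z = K)))
       \<and> (\<not> (\<exists>(D :: complex set) (h :: complex \<Rightarrow> real).
             modular_graph D h \<and> (\<exists>K>0. \<forall>z\<in>D. gauss_curvature h z = K)))"
proof (intro conjI notI; elim exE conjE)
  fix D h K
  assume graph: "modular_graph D h" and convex: "convex_graph D h"
    and curv: "\<forall>z\<in>D. gauss_curvature h z = K"
  obtain z where z: "z \<in> D" using graph unfolding modular_graph_def by blast
  have "1 + (pdx h z)\<^sup>2 + (pdy h z)\<^sup>2 > 0"
    by (simp add: add_pos_nonneg)
  with convex z have "gauss_curvature h z > 0"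
    by (simp add: convex_graph_def gauss_curvature_def)
  with curv z have "K > 0" by simp
  with graph curv show False
    using no_modular_graph_constant_positive_curvature by blast
next
  fix D h K
  assume "modular_graph D h" "K > 0" "\<forall>z\<in>D. gauss_curvature h z = K"
  then show False
    using no_modular_graph_constant_positive_curvature by blast
qed

end
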